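(* Let $S=(1,1,1,2,2,2,\ldots)$, i.e. $a_1=a_2=a_3=1$ and $a_i=2$ for all $i\geq 4$, and let $n\geq 3$. Then $$\chi_S''(C_n)=\begin{cases}3, & n\equiv 0 \pmod 3,\\ 4, & n\not\equiv 0 \pmod 3 \text{ and } n\neq 4,\\ 5, & n=4.\end{cases}$$
   Context: $C_n$ is the cycle on $n$ vertices. For vertices $u,v$ of a graph $G$, $d(u,v)$ is the usual shortest-path distance. For a vertex $u$ and an edge $ab$, $d(u,ab)=d(ab,u)=\min\{d(u,a),d(u,b)\}+1$. For two distinct edges $ab,cd$, $d(ab,cd)=\min\{d(a,c),d(a,d),d(b,c),d(b,d)\}+1$. For a non-decreasing infinite sequence $S=(a_1,a_2,\ldots)$ of positive integers, an $S$-packing total coloring of $G$ using $k$ colors is a map $c:V(G)\cup E(G)\to\{1,\ldots,k\}$ such that any two distinct elements $A,B\in V(G)\cup E(G)$ with $c(A)=c(B)=i$ satisfy $d(A,B)>a_i$. The $S$-packing total chromatic number $\chi_S''(G)$ is the smallest $k$ for which one exists. *)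

theory Defs
  imports "HOL-Library.Extended_Nat" "HOL-Library.FuncSet"
begin

type_synonym 'a graph = "'a set \<times> 'a set set"

abbreviation verts :: "'a graph \<Rightarrow> 'a set" where
  "verts G \<equiv> fst G"

abbreviation edges :: "'a graph \<Rightarrow> 'a set set" where
  "edges G \<equiv> snd G"

definition simple_graph :: "'a graph \<Rightarrow> bool" where
  "simple_graph G \<longleftrightarrow> finite (verts G) \<and> (\<forall>e\<in>edges G. e \<subseteq> verts G \<and> card e = 2)"

definition cycle_graph :: "nat \<Rightarrow> nat graph" where
  "cycle_graph n = ({..<n}, {{i, Suc i mod n} |i. i < n})"

lemma simple_graph_cycle_graph:
  assumes "n \<ge> 3"
  shows "simple_graph (cycle_graph n)"
  using assms by (auto simp: simple_graph_def cycle_graph_def card_insert_if mod_Suc)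

definition path :: "'a graph \<Rightarrow> 'a list \<Rightarrow> bool" where
  "path G p \<longleftrightarrow> p \<noteq> [] \<and> distinct p \<and> set p \<subseteq> verts G
     \<and> (\<forall>i. Suc i < length p \<longrightarrow> {p ! i, p ! Suc i} \<in> edges G)"

text \<open>The distance is infinite if there is no path (the infimum of the empty set).\<close>

definition vdist :: "'a graph \<Rightarrow> 'a \<Rightarrow> 'a \<Rightarrow> enat" where
  "vdist G u v = (INF p\<in>{p. path G p \<and> hd p = u \<and> last p = v}. enat (length p - 1))"

text \<open>
  The elements of \<open>V(G) \<union> E(G)\<close> are those of the disjoint sum \<open>verts G <+> edges G\<close>.
  An infimum over an edge is the minimum over its two endpoints.
  The distance of an edge to itself is set to zero; the colorings below use
  distances between distinct elements only.
\<close>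

fun tdist :: "'a graph \<Rightarrow> 'a + 'a set \<Rightarrow> 'a + 'a set \<Rightarrow> enat" where
  "tdist G (Inl u) (Inl v) = vdist G u v"
| "tdist G (Inl u) (Inr e) = (INF a\<in>e. vdist G u a) + 1"
| "tdist G (Inr e) (Inl u) = (INF a\<in>e. vdist G u a) + 1"
| "tdist G (Inr e) (Inr f) = (if e = f then 0 else (INF a\<in>e. INF b\<in>f. vdist G a b) + 1)"

text \<open>
  The sequence \<open>S = (a\<^sub>1, a\<^sub>2, \<dots>)\<close> is a function with \<open>S i = a\<^sub>i\<close> for \<open>i \<ge> 1\<close>;
  the value \<open>S 0\<close> is never used.
\<close>

definition packing_sequence :: "(nat \<Rightarrow> nat) \<Rightarrow> bool" where
  "packing_sequence S \<longleftrightarrow> mono_on {1..} S \<and> (\<forall>i\<ge>1. S i > 0)"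

definition packing_total_coloring ::
    "(nat \<Rightarrow> nat) \<Rightarrow> 'a graph \<Rightarrow> nat \<Rightarrow> ('a + 'a set \<Rightarrow> nat) \<Rightarrow> bool" where
  "packing_total_coloring S G k c \<longleftrightarrow>
     packing_sequence S \<and>
     c \<in> (verts G <+> edges G) \<rightarrow> {1..k} \<and>
     (\<forall>A\<in>verts G <+> edges G. \<forall>B\<in>verts G <+> edges G.
        A \<noteq> B \<and> c A = c B \<longrightarrow> tdist G A B > enat (S (c A)))"

text \<open>
  A finite value of this infimum is attained, hence is the smallest number of colors;
  the value is infinite if there is no coloring.
\<close>

definition packing_total_chromatic_number :: "(nat \<Rightarrow> nat) \<Rightarrow> 'a graph \<Rightarrow> enat" where
  "packing_total_chromatic_number S G = (INF k\<in>{k. \<exists>c. packing_total_coloring S G k c}. enat k)"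

end

theory Submission
  imports Defs
begin

text \<open>
  Walk once around \<open>C\<^sub>n\<close> and list its elements alternately as vertex, edge, vertex, edge, \<dots>.
  This places the \<open>2n\<close> elements at the positions \<open>0, \<dots>, 2n - 1\<close> of a longer cycle, and
  the distance of two elements is half the cyclic distance of their positions, rounded up
  (\<open>tdist_cycle_element\<close>). Two elements are therefore at distance more than \<open>s\<close> iff their
  positions are at cyclic distance more than \<open>2s\<close>, and a packing total coloring is a
  cyclic word of length \<open>2n\<close> in which equal letters \<open>i\<close> are at cyclic distance more than
  \<open>2 S(i)\<close> (\<open>ex_packing_total_coloring_cycle_iff\<close>): at least 3 for the letters 1, 2, 3, and at
  least 5 for all others. Everything else is about such words.

  Lower bounds. Any three cyclically consecutive letters are distinct, so at least three
  letters are needed. If there are only three, each letter is determined by the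
  two before it, so the word has period 3, and closing up the cycle forces \<open>3 dvd 2n\<close>
  (\<open>packing_word_3_imp_dvd\<close>). A word of length 8 (the case \<open>n = 4\<close>) has room for at most two
  copies each of 1, 2, 3 and for one 4, which leaves a position without a letter.

  Upper bounds. If 3 divides \<open>2n\<close>, repeat \<open>123\<close>. If \<open>2n mod 3 = 1\<close>, append a single 4 to
  the repetition. If \<open>2n mod 3 = 2\<close>, the word \<open>123 1234 123 \<dots> 123 4\<close> uses two
  letters 4. The cyclic gaps between them are 7 and \<open>2n - 7\<close>, so this
  works once \<open>2n \<ge> 14\<close>; as \<open>2n\<close> is even, the only smaller length is 8, where the
  last letter has to be a 5.
\<close>

section \<open>Distances in a cycle\<close>

definition cyc_dist :: "nat \<Rightarrow> nat \<Rightarrow> nat \<Rightarrow> nat" where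
  "cyc_dist m p q = (let d = max p q - min p q in min d (m - d))"

lemma cyc_dist_commute: "cyc_dist m p q = cyc_dist m q p"
  by (simp add: cyc_dist_def max.commute min.commute)

lemma cyc_dist_less: "p < q \<Longrightarrow> cyc_dist m p q = min (q - p) (m - (q - p))"
  by (simp add: cyc_dist_def)

lemma cyc_dist_greater: "q < p \<Longrightarrow> cyc_dist m p q = min (p - q) (m - (p - q))"
  by (simp add: cyc_dist_def)

text \<open>
  Naming the lengths of the two arcs between the positions avoids truncated
  subtraction, which would otherwise split into many cases.
\<close>

lemma cyc_dist_arcs:
  assumes "q = p + d" "m = d + e"
  shows "cyc_dist m p q = min d e" "cyc_dist m q p = min d e"
  using assms by (auto simp: cyc_dist_def)

lemma cyc_dist_self [simp]: "cyc_dist m p p = 0"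
  by (simp add: cyc_dist_def)

lemma cyc_dist_Suc_mod:
  assumes "i < m" "j < m"
  shows "cyc_dist m i (Suc j mod m) \<le> Suc (cyc_dist m i j)"
    and "cyc_dist m i j \<le> Suc (cyc_dist m i (Suc j mod m))"
  using assms by (auto simp: cyc_dist_def Let_def mod_Suc min_def max_def)

lemma cyc_dist_shift:
  assumes "k < m" "i < m"
  shows "cyc_dist m i ((i + k) mod m) = min k (m - k)"
  using assms by (auto simp: cyc_dist_def Let_def mod_if min_def max_def)

text \<open>
  Each edge changes the cyclic distance to the starting vertex by at most one. This
  is the lower bound for the graph distance.
\<close>

lemma path_cycle_cyc_dist_le:
  assumes "path (cycle_graph n) p" "k < length p"
  shows "cyc_dist n (hd p) (p ! k) \<le> k"
  using assms(2)
proof (induction k)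
  case 0
  then show ?case by (simp add: hd_conv_nth)
next
  case (Suc k)
  have verts: "p ! j < n" if "j < length p" for j
    using assms(1) nth_mem[OF that] by (auto simp: path_def cycle_graph_def)
  have hd: "hd p < n"
    using verts[of 0] Suc.prems by (cases p) auto
  have "{p ! k, p ! Suc k} \<in> edges (cycle_graph n)"
    using assms(1) Suc.prems by (auto simp: path_def)
  then obtain i where "i < n" "{p ! k, p ! Suc k} = {i, Suc i mod n}"
    by (auto simp: cycle_graph_def)
  then have "p ! Suc k = Suc (p ! k) mod n \<or> p ! k = Suc (p ! Suc k) mod n"
    by (auto simp: doubleton_eq_iff)
  then show ?case
    using Suc cyc_dist_Suc_mod[OF hd verts[of k]] cyc_dist_Suc_mod[OF hd verts[of "Suc k"]]
    by force
qed

lemma path_rev: "path G p \<Longrightarrow> path G (rev p)"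
  unfolding path_def
proof (intro conjI allI impI; (elim conjE)?)
  fix i
  assume e: "\<forall>i. Suc i < length p \<longrightarrow> {p ! i, p ! Suc i} \<in> edges G" and i: "Suc i < length (rev p)"
  let ?j = "length p - Suc (Suc i)"
  have "{p ! ?j, p ! Suc ?j} \<in> edges G"
    using e i by auto
  moreover have "Suc ?j = length p - Suc i"
    using i by auto
  ultimately show "{rev p ! i, rev p ! Suc i} \<in> edges G"
    using i by (simp add: rev_nth insert_commute)
qed auto

lemma vdist_commute: "vdist G u v = vdist G v u"
proof -
  have "vdist G u v \<le> vdist G v u" for u v
    unfolding vdist_def
  proof (rule INF_greatest)
    fix p assume p: "p \<in> {p. path G p \<and> hd p = v \<and> last p = u}"
    then have "rev p \<in> {p. path G p \<and> hd p = u \<and> last p = v}"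
      by (auto simp: path_rev hd_rev last_rev)
    then show "(INF p\<in>{p. path G p \<and> hd p = u \<and> last p = v}. enat (length p - 1))
        \<le> enat (length p - 1)"
      by (rule INF_lower2) simp
  qed
  then show ?thesis by (simp add: antisym)
qed

text \<open>
  The witness walks \<open>k\<close> steps in the positive direction; since \<open>k < n\<close>, no vertex
  is repeated.
\<close>

lemma vdist_cycle_shift_le:
  assumes "i < n" "k < n"
  shows "vdist (cycle_graph n) i ((i + k) mod n) \<le> enat k"
proof -
  let ?p = "map (\<lambda>t. (i + t) mod n) [0..<Suc k]"
  have "inj_on (\<lambda>t. (i + t) mod n) {0..<Suc k}"
  proof (rule inj_onI)
    fix s t assume "s \<in> {0..<Suc k}" "t \<in> {0..<Suc k}" "(i + s) mod n = (i + t) mod n"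
    then show "s = t"
      using assms by (auto simp: mod_if split: if_splits)
  qed
  then have "distinct ?p"
    by (simp only: distinct_map set_upt distinct_upt simp_thms)
  moreover have "{?p ! t, ?p ! Suc t} \<in> edges (cycle_graph n)" if "Suc t < length ?p" for t
  proof -
    have "?p ! t = (i + t) mod n" "?p ! Suc t = Suc ((i + t) mod n) mod n"
      using that by (simp_all del: upt_Suc add: mod_Suc_eq)
    moreover have "(i + t) mod n < n"
      using assms by simp
    ultimately show ?thesis
      unfolding cycle_graph_def by auto
  qed
  moreover have "set ?p \<subseteq> verts (cycle_graph n)" "?p \<noteq> []"
    using assms by (auto simp: cycle_graph_def)
  ultimately have "path (cycle_graph n) ?p"
    unfolding path_def by blast
  moreover have "hd ?p = i"
    using assms by (simp add: hd_map del: upt_Suc)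
  moreover have "last ?p = (i + k) mod n"
    by simp
  ultimately show ?thesis
    unfolding vdist_def by (intro INF_lower2[of ?p]) auto
qed

lemma vdist_cycle:
  assumes "i < n" "j < n"
  shows "vdist (cycle_graph n) i j = enat (cyc_dist n i j)"
proof (rule antisym)
  \<comment> \<open>the length of the arc from \<open>i\<close> to \<open>j\<close> in the positive direction\<close>
  define k where "k = (if i \<le> j then j - i else n - (i - j))"
  have k: "k < n" "j = (i + k) mod n"
    using assms by (auto simp: k_def)
  have k': "i = (j + (n - k)) mod n"
  proof (cases "i \<le> j")
    case True
    then have "j + (n - k) = i + n" using assms by (simp add: k_def)
    then show ?thesis using assms by simp
  next
    case False
    then show ?thesis using assms by (simp add: k_def)
  qed
  have D: "cyc_dist n i j = min k (n - k)"
    using cyc_dist_shift[OF k(1) assms(1)] k(2) by simp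
  have "vdist (cycle_graph n) i j \<le> enat k"
    using vdist_cycle_shift_le[OF assms(1) k(1)] k(2) by simp
  moreover have "vdist (cycle_graph n) i j \<le> enat (n - k)" if "k \<noteq> 0"
    using vdist_cycle_shift_le[OF assms(2), of "n - k"] that k(1) k' vdist_commute[of _ i j]
    by (metis diff_less not_gr_zero less_trans)
  ultimately show "vdist (cycle_graph n) i j \<le> enat (cyc_dist n i j)"
    unfolding D by (cases "k = 0") (auto simp: min_def)
next
  show "enat (cyc_dist n i j) \<le> vdist (cycle_graph n) i j"
    unfolding vdist_def
  proof (rule INF_greatest)
    fix p assume p: "p \<in> {p. path (cycle_graph n) p \<and> hd p = i \<and> last p = j}"
    then have "p \<noteq> []" by (auto simp: path_def)
    then show "enat (cyc_dist n i j) \<le> enat (length p - 1)"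
      using p path_cycle_cyc_dist_le[of n p "length p - 1"] by (auto simp: last_conv_nth)
  qed
qed

section \<open>Total colorings of a cycle as cyclic words\<close>

text \<open>
  The vertex \<open>i\<close> is at position \<open>2i\<close>, and the edge from \<open>i\<close> to its successor at
  position \<open>2i + 1\<close>.
\<close>

definition cycle_element :: "nat \<Rightarrow> nat \<Rightarrow> nat + nat set" where
  "cycle_element n p =
     (if even p then Inl (p div 2) else Inr {p div 2, Suc (p div 2) mod n})"

text \<open>
  The bound on \<open>n\<close> matters: for \<open>n = 2\<close> the edges leaving 0 and 1 coincide.
\<close>

lemma cycle_edge_eq_iff:
  assumes "n \<ge> 3" "i < n" "j < n"
  shows "{i, Suc i mod n} = {j, Suc j mod n} \<longleftrightarrow> i = j"
  using assms by (auto simp: doubleton_eq_iff mod_Suc split: if_splits)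

lemma bij_betw_cycle_element:
  assumes "n \<ge> 3"
  shows "bij_betw (cycle_element n) {..<2 * n} (verts (cycle_graph n) <+> edges (cycle_graph n))"
proof (rule bij_betw_imageI)
  show "inj_on (cycle_element n) {..<2 * n}"
  proof (rule inj_onI)
    fix p q assume "p \<in> {..<2 * n}" "q \<in> {..<2 * n}" "cycle_element n p = cycle_element n q"
    then have "even p = even q" "p div 2 = q div 2"
      using cycle_edge_eq_iff[OF assms, of "p div 2" "q div 2"]
      by (auto simp: cycle_element_def split: if_splits)
    then show "p = q"
      by (metis even_two_times_div_two odd_two_times_div_two_succ)
  qed
  have "Inl i \<in> cycle_element n ` {..<2 * n}"
    "Inr {i, Suc i mod n} \<in> cycle_element n ` {..<2 * n}" if "i < n" for i
    using that by (auto simp: cycle_element_def intro: image_eqI[of _ _ "2 * i"]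
        image_eqI[of _ _ "Suc (2 * i)"])
  then show "cycle_element n ` {..<2 * n} = verts (cycle_graph n) <+> edges (cycle_graph n)"
    by (auto simp: cycle_graph_def cycle_element_def)
qed

text \<open>
  The next three lemmas compare distances on the cycle of \<open>2n\<close> positions with those on
  the cycle of \<open>n\<close> vertices. Their right-hand sides are twice the element distances of
  the graph, written as a minimum over the endpoints of the edges. The left-hand
  side is the position distance, increased by one where it is odd.
\<close>

lemma cyc_dist_vertex_vertex: "cyc_dist (2 * n) (2 * i) (2 * j) = 2 * cyc_dist n i j"
  by (cases i j rule: linorder_cases) (simp_all add: cyc_dist_less cyc_dist_greater)

lemma cyc_dist_vertex_edge:
  assumes "i < n" "j < n"
  shows "cyc_dist (2 * n) (2 * i) (2 * j + 1) + 1
    = 2 * (min (cyc_dist n i j) (cyc_dist n i (Suc j mod n)) + 1)"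
proof (cases "i \<le> j")
  case True
  then obtain d where j: "j = i + d" using le_Suc_ex by blast
  obtain e where n: "n = i + d + 1 + e"
    using assms j by (metis Suc_eq_plus1 Suc_leI le_Suc_ex)
  have "cyc_dist n i (Suc j mod n) = min (Suc d) (i + e)"
  proof (cases "e = 0")
    case True
    \<comment> \<open>the edge at \<open>j\<close> closes the cycle: its second endpoint is vertex 0\<close>
    then have "Suc j mod n = 0" using n j by simp
    then show ?thesis using cyc_dist_arcs(2)[of i 0 i n "Suc d"] n True
      by (simp add: min.commute)
  next
    case False
    then have "Suc j mod n = i + Suc d" using n j by simp
    then show ?thesis using n by (simp add: cyc_dist_arcs(1)[of _ i "Suc d" _ "i + e"])
  qed
  moreover have "cyc_dist n i j = min d (i + e + 1)"
    using n j by (intro cyc_dist_arcs(1)) auto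
  moreover have "cyc_dist (2 * n) (2 * i) (2 * j + 1) = min (2 * d + 1) (2 * i + 2 * e + 1)"
    using n j by (intro cyc_dist_arcs(1)) auto
  ultimately show ?thesis by (auto simp: min_def)
next
  case False
  then obtain d where i: "i = Suc j + d" using le_Suc_ex by (metis not_less_eq_eq)
  obtain e where n: "n = Suc j + d + 1 + e"
    using assms i by (metis Suc_eq_plus1 Suc_leI le_Suc_ex)
  have "Suc j mod n = Suc j" using n by simp
  moreover have "cyc_dist n i (Suc j) = min d (j + e + 2)" 
    using n i by (intro cyc_dist_arcs(2)) auto
  moreover have "cyc_dist n i j = min (d + 1) (j + e + 1)" 
    using n i by (intro cyc_dist_arcs(2)) auto
  moreover have "cyc_dist (2 * n) (2 * i) (2 * j + 1) = min (2 * d + 1) (2 * j + 2 * e + 3)"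
    using n i by (intro cyc_dist_arcs(2)) auto
  ultimately show ?thesis by (auto simp: min_def)
qed

lemma cyc_dist_edge_edge:
  assumes "i < n" "j < n" "i \<noteq> j"
  shows "cyc_dist (2 * n) (2 * i + 1) (2 * j + 1)
    = 2 * (min (min (cyc_dist n i j) (cyc_dist n i (Suc j mod n)))
          (min (cyc_dist n (Suc i mod n) j) (cyc_dist n (Suc i mod n) (Suc j mod n))) + 1)"
    (is "?T i j")
proof -
  have *: "?T i j" if ij: "i < j" "j < n" for i j
  proof -
    obtain d where j: "j = Suc i + d" using ij le_Suc_ex by (metis Suc_leI)
    obtain e where n: "n = Suc i + d + 1 + e"
      using ij j by (metis Suc_eq_plus1 Suc_leI le_Suc_ex)
    have i: "Suc i mod n = Suc i" using n by simp
    have "cyc_dist n i (Suc j mod n) = min (d + 2) (i + e)"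
      "cyc_dist n (Suc i) (Suc j mod n) = min (d + 1) (i + e + 1)"
    proof (atomize (full), cases "e = 0")
      case True
      \<comment> \<open>the edge at \<open>j\<close> closes the cycle: its second endpoint is vertex 0\<close>
      then have "Suc j mod n = 0" using n j by simp
      then show "cyc_dist n i (Suc j mod n) = min (d + 2) (i + e) \<and>
        cyc_dist n (Suc i) (Suc j mod n) = min (d + 1) (i + e + 1)"
        using cyc_dist_arcs(2)[of i 0 i n "d + 2"] cyc_dist_arcs(2)[of "Suc i" 0 "Suc i" n "d + 1"] n True
        by (simp add: min.commute)
    next
      case False
      then have "Suc j mod n = i + d + 2" using n j by simp
      moreover have "cyc_dist n i (i + d + 2) = min (d + 2) (i + e)"
        using n by (intro cyc_dist_arcs(1)) auto
      moreover have "cyc_dist n (Suc i) (i + d + 2) = min (d + 1) (i + e + 1)"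
        using n by (intro cyc_dist_arcs(1)) auto
      ultimately show "cyc_dist n i (Suc j mod n) = min (d + 2) (i + e) \<and>
        cyc_dist n (Suc i) (Suc j mod n) = min (d + 1) (i + e + 1)"
        by simp
    qed
    moreover have "cyc_dist n i j = min (d + 1) (i + e + 1)"
      using n j by (intro cyc_dist_arcs(1)) auto
    moreover have "cyc_dist n (Suc i) j = min d (i + e + 2)"
      using n j by (intro cyc_dist_arcs(1)) auto
    moreover have "cyc_dist (2 * n) (2 * i + 1) (2 * j + 1) = min (2 * d + 2) (2 * i + 2 * e + 2)"
      using n j by (intro cyc_dist_arcs(1)) auto
    ultimately show "?T i j" unfolding i by (auto simp: min_def)
  qed
  show ?thesis
  proof (cases i j rule: linorder_cases)
    case greater
    have middle_swap: "min (min a b) (min c d) = min (min a c) (min b d)" for a b c d :: nat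
      unfolding min.assoc by (subst min.left_commute[of b]) (rule refl)
    have "?T j i" using *[OF greater assms(1)] .
    then show ?thesis
      unfolding cyc_dist_commute[of "2 * n" "2 * i + 1" "2 * j + 1"]
        cyc_dist_commute[of n i j] cyc_dist_commute[of n i "Suc j mod n"]
        cyc_dist_commute[of n "Suc i mod n" j] cyc_dist_commute[of n "Suc i mod n" "Suc j mod n"]
      by (subst middle_swap)
  next
    case less
    then show ?thesis using assms(2) by (rule *)
  qed (use assms in simp)
qed

lemma tdist_cycle_element:
  assumes n: "n \<ge> 3" and pq: "p < 2 * n" "q < 2 * n"
  shows "tdist (cycle_graph n) (cycle_element n p) (cycle_element n q)
    = enat ((cyc_dist (2 * n) p q + 1) div 2)"
proof -
  define i where "i = p div 2"
  define j where "j = q div 2"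
  have ij: "i < n" "j < n" "Suc i mod n < n" "Suc j mod n < n"
    using pq by (auto simp: i_def j_def)
  note d = vdist_cycle[OF ij(1) ij(2)] vdist_cycle[OF ij(1) ij(4)]
    vdist_cycle[OF ij(3) ij(2)] vdist_cycle[OF ij(3) ij(4)] vdist_cycle[OF ij(2) ij(3)]
    vdist_cycle[OF ij(2) ij(1)]
  consider "p = 2 * i" "q = 2 * j" | "p = 2 * i" "q = 2 * j + 1"
    | "p = 2 * i + 1" "q = 2 * j" | "p = 2 * i + 1" "q = 2 * j + 1"
    unfolding i_def j_def by (metis even_two_times_div_two odd_two_times_div_two_succ)
  then show ?thesis
  proof cases
    case 1
    then show ?thesis
      using d cyc_dist_vertex_vertex[of n i j] by (simp add: cycle_element_def)
  next
    case 2
    then show ?thesis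
      using d cyc_dist_vertex_edge[OF ij(1,2)]
      by (simp add: cycle_element_def inf_enat_def one_enat_def)
  next
    case 3
    then show ?thesis
      using d cyc_dist_vertex_edge[OF ij(2,1)] cyc_dist_commute[of "2 * n" p q]
      by (simp add: cycle_element_def inf_enat_def one_enat_def)
  next
    case 4
    show ?thesis
    proof (cases "i = j")
      case True
      then show ?thesis using 4 by (simp add: cycle_element_def zero_enat_def)
    next
      case False
      then show ?thesis
        using 4 d cyc_dist_edge_edge[OF ij(1,2)] cycle_edge_eq_iff[OF n ij(1,2)]
        by (simp add: cycle_element_def inf_enat_def one_enat_def)
    qed
  qed
qed

text \<open>
  Cyclic words of length \<open>m\<close> over the letters \<open>1, \<dots>, k\<close>. The factor 2 accounts for the
  interleaving of vertices and edges.
\<close>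

definition packing_word :: "(nat \<Rightarrow> nat) \<Rightarrow> nat \<Rightarrow> nat \<Rightarrow> (nat \<Rightarrow> nat) \<Rightarrow> bool" where
  "packing_word S m k w \<longleftrightarrow> w \<in> {..<m} \<rightarrow> {1..k} \<and>
     (\<forall>p<m. \<forall>q<m. p \<noteq> q \<and> w p = w q \<longrightarrow> 2 * S (w p) < cyc_dist m p q)"

lemma packing_wordI:
  assumes "\<And>p. p < m \<Longrightarrow> w p \<in> {1..k}"
    and "\<And>p q. \<lbrakk>p < q; q < m; w p = w q\<rbrakk> \<Longrightarrow> 2 * S (w p) < q - p \<and> 2 * S (w p) < m - (q - p)"
  shows "packing_word S m k w"
  unfolding packing_word_def
proof (intro conjI allI impI)
  fix p q assume "p < m" "q < m" "p \<noteq> q \<and> w p = w q"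
  then show "2 * S (w p) < cyc_dist m p q"
    using assms(2)[of p q] assms(2)[of q p]
    by (cases p q rule: linorder_cases)
      (auto simp: cyc_dist_less cyc_dist_greater)
qed (use assms(1) in auto)

lemma packing_word_cyc_dist:
  assumes "packing_word S m k w" "p < m" "q < m" "p \<noteq> q" "w p = w q"
  shows "2 * S (w p) < cyc_dist m p q"
  using assms unfolding packing_word_def by blast

lemma packing_wordD:
  assumes "packing_word S m k w" "p < q" "q < m" "w p = w q"
  shows "2 * S (w p) < q - p" "2 * S (w p) < m - (q - p)"
  using packing_word_cyc_dist[OF assms(1), of p q] assms(2-4) by (simp_all add: cyc_dist_less)

text \<open>
  For natural numbers \<open>s\<close> and \<open>d\<close>, the rounded-up half of \<open>d\<close> exceeds \<open>s\<close> iff \<open>d > 2s\<close>. So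
  reading a coloring along the positions turns its condition into that of a word.
\<close>

lemma ex_packing_total_coloring_cycle_iff:
  assumes n: "n \<ge> 3" and S: "packing_sequence S"
  shows "(\<exists>c. packing_total_coloring S (cycle_graph n) k c) \<longleftrightarrow> (\<exists>w. packing_word S (2 * n) k w)"
proof -
  let ?f = "cycle_element n" and ?X = "verts (cycle_graph n) <+> edges (cycle_graph n)"
  note bij = bij_betw_cycle_element[OF n]
  have X: "?X = ?f ` {..<2 * n}"
    using bij by (simp add: bij_betw_def)
  have inj: "?f p = ?f q \<longleftrightarrow> p = q" if "p < 2 * n" "q < 2 * n" for p q
    using bij that by (auto simp: bij_betw_def inj_on_def)
  have key: "packing_total_coloring S (cycle_graph n) k c \<longleftrightarrow> packing_word S (2 * n) k (c \<circ> ?f)" for c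
  proof -
    have dist: "enat s < tdist (cycle_graph n) (?f p) (?f q) \<longleftrightarrow> 2 * s < cyc_dist (2 * n) p q"
      if "p < 2 * n" "q < 2 * n" for p q s
      using that by (simp add: tdist_cycle_element[OF n]) linarith
    show ?thesis
      unfolding packing_total_coloring_def packing_word_def X
      using S inj dist by (auto simp: Pi_iff)
  qed
  show ?thesis
  proof
    assume "\<exists>w. packing_word S (2 * n) k w"
    then obtain w where w: "packing_word S (2 * n) k w" ..
    let ?c = "w \<circ> inv_into {..<2 * n} ?f"
    have "(?c \<circ> ?f) p = w p" if "p < 2 * n" for p
      using bij that by (simp add: bij_betw_def)
    then have "packing_word S (2 * n) k (?c \<circ> ?f)"
      using w unfolding packing_word_def by (simp add: Pi_iff)
    then show "\<exists>c. packing_total_coloring S (cycle_graph n) k c"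
      using key by blast
  qed (use key in blast)
qed

lemma packing_total_chromatic_number_cycle_eqI:
  assumes "n \<ge> 3" "packing_sequence S"
    and "packing_word S (2 * n) k w"
    and "\<And>k' w. packing_word S (2 * n) k' w \<Longrightarrow> k \<le> k'"
  shows "packing_total_chromatic_number S (cycle_graph n) = enat k"
  unfolding packing_total_chromatic_number_def ex_packing_total_coloring_cycle_iff[OF assms(1,2)]
  using assms(3,4) by (intro antisym INF_greatest INF_lower) auto

section \<open>Lower bounds\<close>

lemma packing_word_consecutive:
  assumes S: "\<And>i. i \<ge> 1 \<Longrightarrow> S i \<ge> 1" and w: "packing_word S m k w"
    and pq: "p < q" "q < m" "q - p < 3 \<or> m - (q - p) < 3"
  shows "w p \<noteq> w q"
proof
  assume eq: "w p = w q"
  have "w p \<ge> 1"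
    using w pq by (auto simp: packing_word_def Pi_iff)
  then show False
    using S[of "w p"] packing_wordD[OF w pq(1,2) eq] pq(3) by linarith
qed

lemma packing_word_ge_3:
  assumes S: "\<And>i. i \<ge> 1 \<Longrightarrow> S i \<ge> 1" and w: "packing_word S m k w" and m: "m \<ge> 3"
  shows "k \<ge> 3"
proof -
  have "w 0 \<noteq> w 1" "w 0 \<noteq> w 2" "w 1 \<noteq> w 2"
    using m by (intro packing_word_consecutive[OF S w]; simp)+
  moreover have "w 0 \<in> {1..k}" "w 1 \<in> {1..k}" "w 2 \<in> {1..k}"
    using w m by (auto simp: packing_word_def Pi_iff)
  ultimately show ?thesis
    by auto
qed

text \<open>
  With three letters, positions \<open>p\<close> and \<open>p + 3\<close> carry the one letter that is absent from
  the two positions between them. So the word is determined by its first three letters. The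
  last letter differs from the first two, hence it is the third, and the last position
  is congruent to 2 modulo 3.
\<close>

lemma packing_word_3_imp_dvd:
  assumes S: "\<And>i. i \<ge> 1 \<Longrightarrow> S i \<ge> 1" and w: "packing_word S m 3 w" and m: "m \<ge> 3"
  shows "3 dvd m"
proof -
  note ne = packing_word_consecutive[OF S w]
  have range: "w p \<in> {1..3}" if "p < m" for p
    using w that by (auto simp: packing_word_def Pi_iff)
  have pigeonhole: "d = a"
    if "a \<noteq> b" "a \<noteq> c" "b \<noteq> c" "b \<noteq> d" "c \<noteq> d" "a \<in> {1..3}" "b \<in> {1..3}" "c \<in> {1..3}" "d \<in> {1..3}"
    for a b c d :: nat
  proof -
    have "{a, b, c} = {1..3}"
      using that by (intro card_subset_eq) auto
    then show ?thesis using that by blast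
  qed
  have period: "w (p + 3) = w p" if "p + 3 < m" for p
    by (rule pigeonhole[of "w p" "w (p + 1)" "w (p + 2)" "w (p + 3)",
          OF ne ne ne ne ne range range range range])
      (use that in simp_all)
  have mod3: "w p = w (p mod 3)" if "p < m" for p
    using that
  proof (induction p rule: less_induct)
    case (less p)
    show ?case
    proof (cases "p < 3")
      case False
      then have "w p = w (p - 3)"
        using period[of "p - 3"] less.prems by simp
      also have "\<dots> = w ((p - 3) mod 3)"
        by (rule less.IH) (use False less.prems in simp_all)
      also have "(p - 3) mod 3 = p mod 3"
        using False by (simp add: le_mod_geq)
      finally show ?thesis .
    qed simp
  qed
  have "w 0 \<noteq> w (m - 1)" "w 1 \<noteq> w (m - 1)"
    by (rule ne; use m in arith)+
  moreover have "w (m - 1) = w ((m - 1) mod 3)"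
    using m by (intro mod3) simp
  ultimately have "(m - 1) mod 3 \<noteq> 0" "(m - 1) mod 3 \<noteq> 1"
    by metis+
  then have "(m - 1) mod 3 = 2"
    using mod_less_divisor[of 3 "m - 1"] by linarith
  then have "Suc (m - 1) mod 3 = 0"
    by (simp only: mod_Suc) simp
  then show ?thesis
    using m by (simp add: mod_eq_0_iff_dvd)
qed

text \<open>
  The arcs of length \<open>d\<close> that start at the points of \<open>F\<close> are pairwise disjoint.
\<close>

lemma card_cyclic_packing:
  assumes F: "F \<subseteq> {..<m}" and d: "d \<le> m"
    and sep: "\<And>p q. \<lbrakk>p \<in> F; q \<in> F; p \<noteq> q\<rbrakk> \<Longrightarrow> d \<le> cyc_dist m p q"
  shows "card F * d \<le> m"
proof -
  \<comment> \<open>the point at offset \<open>t\<close> on the arc that starts at \<open>p\<close>\<close>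
  let ?h = "\<lambda>(p, t). (p + t) mod m"
  have disjoint: "(p + s) mod m \<noteq> (q + t) mod m"
    if "p \<in> F" "q \<in> F" "p < q" "s < d" "t < d" for p q s t
  proof
    assume eq: "(p + s) mod m = (q + t) mod m"
    have "q < m" "d \<le> q - p" "d \<le> m - (q - p)"
      using that F sep[of p q] by (auto simp: cyc_dist_less)
    then have "p + s \<le> q + t" "0 < (q + t) - (p + s)" "(q + t) - (p + s) < m"
      using that by auto
    then show False
      using eq mod_eq_dvd_iff_nat[of "p + s" "q + t" m] by (auto dest: nat_dvd_not_less)
  qed
  have "inj_on ?h (F \<times> {..<d})"
  proof (rule inj_onI, clarify)
    fix p s q t assume pq: "p \<in> F" "q \<in> F" and st: "s < d" "t < d"
      and eq: "(p + s) mod m = (q + t) mod m"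
    have "p = q"
      using disjoint[of p q s t] disjoint[of q p t s] pq st eq
      by (cases p q rule: linorder_cases) auto
    moreover have "s = t"
    proof -
      have "(s + p) mod m = (t + p) mod m"
        using eq \<open>p = q\<close> by (simp add: add.commute)
      then have "s mod m = t mod m"
        by (simp add: nat_mod_eq_iff)
      then show ?thesis using st d by simp
    qed
    ultimately show "p = q \<and> s = t" ..
  qed
  moreover have "?h ` (F \<times> {..<d}) \<subseteq> {..<m}"
    using F by fastforce
  ultimately have "card (F \<times> {..<d}) \<le> card {..<m}"
    by (intro card_inj_on_le) auto
  then show ?thesis by (simp add: card_cartesian_product)
qed

lemma packing_word_card_le:
  assumes w: "packing_word S m k w" and "2 * S i < m"
  shows "card {p \<in> {..<m}. w p = i} * Suc (2 * S i) \<le> m"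
proof (rule card_cyclic_packing)
  fix p q assume "p \<in> {p \<in> {..<m}. w p = i}" "q \<in> {p \<in> {..<m}. w p = i}" "p \<noteq> q"
  then show "Suc (2 * S i) \<le> cyc_dist m p q"
    using packing_word_cyc_dist[OF w, of p q] by (simp add: Suc_le_eq)
qed (use assms(2) in auto)

text \<open>
  The letters 1, 2, 3 occur at most \<open>8 div 3 = 2\<close> times each and the letter 4 at most
  \<open>8 div 5 = 1\<close> time, which accounts for only 7 of the 8 positions.
\<close>

lemma no_packing_word_8_4:
  assumes S: "S 1 = 1" "S 2 = 1" "S 3 = 1" "S 4 = 2"
  shows "\<not> packing_word S 8 4 w"
proof
  assume w: "packing_word S 8 4 w"
  let ?C = "\<lambda>i. {p \<in> {..<8::nat}. w p = i}"
  have "8 = card (\<Union>i\<in>{1..4}. ?C i)"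
  proof -
    have "(\<Union>i\<in>{1..4}. ?C i) = {..<8}"
      using w by (auto simp: packing_word_def Pi_iff)
    then show ?thesis by simp
  qed
  also have "\<dots> = (\<Sum>i=1..4. card (?C i))"
    by (rule card_UN_disjoint) auto
  also have "\<dots> = card (?C 1) + card (?C 2) + card (?C 3) + card (?C 4)"
    by (simp add: eval_nat_numeral)
  also have "\<dots> \<le> 2 + 2 + 2 + 1"
  proof (intro add_mono)
    show "card (?C 1) \<le> 2" using packing_word_card_le[OF w, of 1] S by simp
    show "card (?C 2) \<le> 2" using packing_word_card_le[OF w, of 2] S by simp
    show "card (?C 3) \<le> 2" using packing_word_card_le[OF w, of 3] S by simp
    show "card (?C 4) \<le> 1" using packing_word_card_le[OF w, of 4] S by simp
  qed
  finally show False by simp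
qed

section \<open>Optimal words\<close>

lemma mod_3_eq_imp_gap:
  fixes p q :: nat
  assumes "p < q" "p mod 3 = q mod 3"
  obtains d where "q = p + 3 * Suc d"
proof -
  have "3 dvd q - p"
    using assms mod_eq_dvd_iff_nat[of p q 3] by simp
  then obtain e where "q - p = 3 * e" ..
  moreover from this obtain d where "e = Suc d"
    using assms(1) by (cases e) auto
  ultimately show ?thesis
    using that[of d] assms(1) by simp
qed

lemma packing_word_mod_0:
  assumes S: "\<And>i. i \<in> {1..3} \<Longrightarrow> S i = 1" and m: "m mod 3 = 0"
  shows "packing_word S m 3 (\<lambda>p. Suc (p mod 3))"
proof (rule packing_wordI)
  fix p q assume *: "p < q" "q < m" "Suc (p mod 3) = Suc (q mod 3)"
  then obtain d where d: "q = p + 3 * Suc d"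
    using mod_3_eq_imp_gap by blast
  obtain a where a: "m = 3 * a"
    using m by auto
  have "S (Suc (p mod 3)) = 1"
    by (rule S) (simp add: Suc_le_eq)
  moreover have "2 < q - p \<and> 2 < m - (q - p)"
    using *(2) unfolding d a by presburger
  ultimately show "2 * S (Suc (p mod 3)) < q - p \<and> 2 * S (Suc (p mod 3)) < m - (q - p)"
    by simp
qed (simp add: Suc_le_eq)

lemma packing_word_mod_1:
  assumes S: "\<And>i. i \<in> {1..3} \<Longrightarrow> S i = 1" and m: "m mod 3 = 1"
  shows "packing_word S m 4 (\<lambda>p. if p = m - 1 then 4 else Suc (p mod 3))"
    (is "packing_word S m 4 ?w")
proof (rule packing_wordI)
  have less: "Suc (r mod 3) < 4" for r :: nat
    by simp
  obtain a where a: "m = 3 * a + 1"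
    using m by (metis mult_div_mod_eq)
  fix p q assume *: "p < q" "q < m" "?w p = ?w q"
  have "p \<noteq> m - 1"
    using *(1,2) by simp
  moreover from this have "q \<noteq> m - 1"
    using *(3) less[of p] by auto
  ultimately have ne: "p \<noteq> m - 1" "q \<noteq> m - 1" and "p mod 3 = q mod 3"
    using *(3) by simp_all
  then obtain d where d: "q = p + 3 * Suc d"
    using mod_3_eq_imp_gap[OF *(1)] by blast
  have "S (?w p) = 1"
    unfolding if_not_P[OF ne(1)] by (rule S) (simp add: Suc_le_eq)
  moreover have "2 < q - p \<and> 2 < m - (q - p)"
    using *(2) ne(2) unfolding d a by presburger
  ultimately show "2 * S (?w p) < q - p \<and> 2 * S (?w p) < m - (q - p)"
    by simp
next
  fix p assume "p < m"
  show "?w p \<in> {1..4}"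
    using mod_less_divisor[of 3 p] by (simp del: mod_less_divisor)
qed

text \<open>
  The word is \<open>123 1234 123 \<dots> 123 c\<close>. Behind the letter 4 at position 6 the
  period restarts at position 7, hence the shift of positions by 2. The last letter \<open>c\<close>
  can be a second 4 only if it is far enough from position 6 on both sides. The distance
  \<open>m - 7\<close> from position \<open>6\<close> to \<open>m - 1\<close> would be too short for \<open>m = 8\<close> and \<open>m = 11\<close>.
\<close>

lemma packing_word_mod_2:
  assumes S: "\<And>i. i \<in> {1..3} \<Longrightarrow> S i = 1" "S 4 = 2" and m: "m mod 3 = 2"
    and c: "c = 4 \<and> m \<ge> 14 \<or> c = 5 \<and> m \<ge> 8"
  shows "packing_word S m c
    (\<lambda>p. if p = 6 then 4 else if p = m - 1 then c else Suc ((if p < 6 then p else p + 2) mod 3))"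
    (is "packing_word S m c ?w")
proof (rule packing_wordI)
  let ?v = "\<lambda>p. if p < 6 then p else p + (2::nat)"
  have less: "Suc (r mod 3) < 4" for r :: nat
    by simp
  obtain a where a: "m = 3 * a + 2"
    using m by (metis mult_div_mod_eq)
  fix p q assume *: "p < q" "q < m" "?w p = ?w q"
  show "2 * S (?w p) < q - p \<and> 2 * S (?w p) < m - (q - p)"
  proof (cases "p = 6 \<or> p = m - 1 \<or> q = 6 \<or> q = m - 1")
    case True
    then have "p = 6 \<and> q = m - 1 \<and> c = 4"
      using * c less[of "?v p"] less[of "?v q"] by (auto split: if_splits)
    then show ?thesis
      using S(2) c by auto
  next
    case False
    then have "?v p mod 3 = ?v q mod 3"
      using *(3) by simp
    moreover have "?v p < ?v q"
      using *(1) by simp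
    ultimately obtain d where d: "?v q = ?v p + 3 * Suc d"
      using mod_3_eq_imp_gap by blast
    have "2 < q - p \<and> 2 < m - (q - p)"
    proof (cases "q < 6")
      case True
      then show ?thesis using d *(1) c by auto
    next
      case q: False
      have "q \<le> 3 * a" using *(2) False unfolding a by simp
      show ?thesis
      proof (cases "p < 6")
        case True
        then have "q = p + 3 * d + 1" using d q by simp
        moreover have "d > 0" using calculation True q False by simp
        ultimately show ?thesis using \<open>q \<le> 3 * a\<close> unfolding a by presburger
      next
        case False
        then have "q = p + 3 * Suc d" using d q by simp
        then show ?thesis using \<open>q \<le> 3 * a\<close> q False unfolding a by presburger
      qed
    qed
    moreover have "S (Suc (?v p mod 3)) = 1"
      by (rule S(1)) (simp add: Suc_le_eq)
    then have "S (?w p) = 1"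
      using False by simp
    ultimately show ?thesis by simp
  qed
next
  fix p assume "p < m"
  have "p' mod 3 < 4" for p' :: nat
    using mod_less_divisor[of 3 p'] by linarith
  then show "?w p \<in> {1..c}"
    using c by (auto simp: Suc_le_eq intro: less_trans)
qed

theorem proposition12:
  fixes S :: "nat \<Rightarrow> nat" and n :: nat
  assumes "S 1 = 1" and "S 2 = 1" and "S 3 = 1"
    and "\<And>i. i \<ge> 4 \<Longrightarrow> S i = 2"
    and "n \<ge> 3"
  shows "packing_total_chromatic_number S (cycle_graph n) =
    (if n mod 3 = 0 then 3 else if n \<noteq> 4 then 4 else 5)"
proof -
  have S13: "S i = 1" if "i \<in> {1..3}" for i
  proof -
    have "i = 1 \<or> i = 2 \<or> i = 3" using that by auto
    then show ?thesis using assms(1-3) by blast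
  qed
  have S4: "S 4 = 2" using assms(4) by simp
  have S_eq: "S i = (if i \<le> 3 then 1 else 2)" if "i \<ge> 1" for i
    using that S13 assms(4) by auto
  have seq: "packing_sequence S"
    unfolding packing_sequence_def by (auto simp: S_eq intro!: mono_onI)
  have pos: "S i \<ge> 1" if "i \<ge> 1" for i
    using S_eq[OF that] by simp
  have ge3: "k \<ge> 3" if "packing_word S (2 * n) k w" for k w
    using packing_word_ge_3[OF pos that] assms(5) by simp
  have ge4: "k \<ge> 4" if "packing_word S (2 * n) k w" "n mod 3 \<noteq> 0" for k w
  proof -
    have "\<not> 3 dvd 2 * n" using that(2) by presburger
    then have "k \<noteq> 3" using packing_word_3_imp_dvd[OF pos] that(1) assms(5) by auto
    then show ?thesis using ge3[OF that(1)] by simp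
  qed
  note eqI = packing_total_chromatic_number_cycle_eqI[OF assms(5) seq]
  consider "n mod 3 = 0" | "n mod 3 = 2" | "n mod 3 = 1" "n \<noteq> 4" | "n = 4"
    by linarith
  then show ?thesis
  proof cases
    case 1
    then have "packing_total_chromatic_number S (cycle_graph n) = enat 3"
      by (intro eqI[OF packing_word_mod_0[of S, OF S13]] ge3) presburger+
    then show ?thesis using 1 by (simp add: numeral_eq_enat)
  next
    case 2
    then have "packing_total_chromatic_number S (cycle_graph n) = enat 4"
      by (intro eqI[OF packing_word_mod_1[of S, OF S13]] ge4) (presburger | simp)+
    then show ?thesis using 2 by (auto simp: numeral_eq_enat)
  next
    case 3
    then have "2 * n mod 3 = 2" "2 * n \<ge> 14"
      using assms(5) by presburger+
    then have "packing_total_chromatic_number S (cycle_graph n) = enat 4"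
      using 3 by (intro eqI[OF packing_word_mod_2[of S, OF S13 S4]] ge4) auto
    then show ?thesis using 3 by (simp add: numeral_eq_enat)
  next
    case 4
    have ge5: "k \<ge> 5" if w: "packing_word S (2 * n) k w" for k w
    proof -
      have "k \<noteq> 4"
        using no_packing_word_8_4[OF assms(1-3) S4] w 4 by auto
      then show ?thesis using ge4[OF w] 4 by simp
    qed
    have "packing_total_chromatic_number S (cycle_graph n) = enat 5"
      using 4 by (intro eqI[OF packing_word_mod_2[of S, OF S13 S4]] ge5) auto
    then show ?thesis using 4 by (simp add: numeral_eq_enat)
  qed
qed

end
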